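(* Let $\mathcal{A}_i:\mathcal{G}\times\prod_{j=1}^{i-1}\mathcal{S}_j\to\mathcal{S}_i$, $i\in\{1,\ldots,k\}$, be randomized algorithms. Suppose that for each $i$ and every $S_1\in\mathcal{S}_1,\ldots,S_{i-1}\in\mathcal{S}_{i-1}$, the average sensitivity of $\mathcal{A}_i(\cdot,S_1,\ldots,S_{i-1})$ with respect to the total variation distance is (at most) $\gamma_i$. Let $\mathcal{A}:\mathcal{G}\to\mathcal{S}_k$ be the randomized algorithm that on input $G$ computes $S_1=\mathcal{A}_1(G)$, $S_2=\mathcal{A}_2(G,S_1)$, …, $S_k=\mathcal{A}_k(G,S_1,\ldots,S_{k-1})$ and outputs $S_k$. Then the average sensitivity of $\mathcal{A}$ with respect to the total variation distance is at most $\sum_{i=1}^k\gamma_i(G)$ for every graph $G$.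
   Context: $\mathcal{G}$ is the set of all finite undirected graphs; $G-e$ is $G$ with edge $e$ deleted. For a randomized algorithm $\mathcal{B}$ with output distribution $\mathcal{B}(G)$, its average sensitivity with respect to the total variation distance at $G=(V,E)$ is $\mathbb{E}_{e\sim E}[d_{\mathrm{TV}}(\mathcal{B}(G),\mathcal{B}(G-e))]$ with $e$ uniform in $E$; auxiliary arguments $S_1,\dots,S_{i-1}$ are held fixed when passing from $G$ to $G-e$. *)

theory Defs
  imports "HOL-Probability.Probability"
begin

datatype 'v graph = Graph (verts: "'v set") (edges: "'v set set")

definition finite_graphs :: "'v graph set" where
  "finite_graphs =
     {G. finite (verts G) \<and> (\<forall>e\<in>edges G. e \<subseteq> verts G \<and> card e = 2)}"

definition delete_edge :: "'v graph \<Rightarrow> 'v set \<Rightarrow> 'v graph" where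
  "delete_edge G e = Graph (verts G) (edges G - {e})"

text \<open>Intended for probability measures on the same measurable space.\<close>

definition tv_dist :: "'a measure \<Rightarrow> 'a measure \<Rightarrow> real" where
  "tv_dist M N = (SUP A\<in>sets M. \<bar>measure M A - measure N A\<bar>)"

text \<open>
  A randomized algorithm is represented by the map sending an input graph to the
  distribution of the output. The uniform distribution on the edges is unspecified if there
  are none, but then \<^term>\<open>delete_edge G e = G\<close> for all \<^term>\<open>e\<close>, so that the average
  sensitivity at \<^term>\<open>G\<close> is 0.
\<close>

definition avg_sensitivity :: "('v graph \<Rightarrow> 'a measure) \<Rightarrow> 'v graph \<Rightarrow> real" where
  "avg_sensitivity B G =
     measure_pmf.expectation (pmf_of_set (edges G)) (\<lambda>e. tv_dist (B G) (B (delete_edge G e)))"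

text \<open>
  The algorithm \<open>\<A>\<^sub>i\<close> is \<open>A i\<close>; its auxiliary arguments \<open>S\<^sub>1, \<dots>, S\<^sub>i\<^sub>-\<^sub>1\<close> are given as a
  function on \<open>{1..<i}\<close>, and \<open>S i\<close> is the measurable space in which its output lies.
  \<open>run S A G n\<close> is the joint distribution of the outputs of the first \<open>n\<close> algorithms.
\<close>

primrec run ::
  "(nat \<Rightarrow> 'a measure) \<Rightarrow> (nat \<Rightarrow> 'v graph \<Rightarrow> (nat \<Rightarrow> 'a) \<Rightarrow> 'a measure)
     \<Rightarrow> 'v graph \<Rightarrow> nat \<Rightarrow> (nat \<Rightarrow> 'a) measure" where
  "run S A G 0 = return (PiM {} S) (\<lambda>_. undefined)"
| "run S A G (Suc n) =
     run S A G n \<bind> (\<lambda>\<omega>. A (Suc n) G \<omega> \<bind>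
       (\<lambda>s. return (PiM {1..Suc n} S) (fun_upd \<omega> (Suc n) s)))"

definition seq_composition ::
  "(nat \<Rightarrow> 'a measure) \<Rightarrow> (nat \<Rightarrow> 'v graph \<Rightarrow> (nat \<Rightarrow> 'a) \<Rightarrow> 'a measure)
     \<Rightarrow> nat \<Rightarrow> 'v graph \<Rightarrow> 'a measure" where
  "seq_composition S A k G = distr (run S A G k) (S k) (\<lambda>\<omega>. \<omega> k)"

end

theory Submission
  imports Defs
begin

text \<open>
  The outputs of the two runs are compared one algorithm at a time, testing the joint
  distributions against measurable functions with values in the unit interval rather than
  against events: the mean of such a function over the last output is again such a function
  of the earlier outputs, which makes an induction on the number of algorithms possible.
  The function \<open>\<omega> \<mapsto> d\<^sub>T\<^sub>V(\<A>\<^sub>i(G, \<omega>), \<A>\<^sub>i(G - e, \<omega>))\<close> need not be measurable, so it is never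
  integrated. Instead one test function is fixed for each edge, the differences of the two
  means (which are measurable in \<open>\<omega>\<close>) are summed over all edges, and the sum is bounded
  pointwise before integrating.
\<close>

section \<open>Total variation distance and means of unit-interval functions\<close>

lemma integrable_unit_interval:
  fixes f :: "'a \<Rightarrow> real"
  assumes "finite_measure M" "f \<in> borel_measurable M" "f \<in> space M \<rightarrow> {0..1}"
  shows "integrable M f"
  using assms
  by (intro finite_measure.integrable_const_bound[of M f 1] AE_I2) (auto simp: Pi_iff abs_le_iff)

lemma bdd_above_tv_dist:
  assumes "prob_space M" "prob_space N"
  shows "bdd_above ((\<lambda>A. \<bar>measure M A - measure N A\<bar>) ` sets M)"
proof (rule bdd_aboveI2)
  fix A
  show "\<bar>measure M A - measure N A\<bar> \<le> 1"
    using prob_space.prob_le_1[OF assms(1), of A] prob_space.prob_le_1[OF assms(2), of A]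
      measure_nonneg[of M A] measure_nonneg[of N A] by linarith
qed

lemma abs_measure_diff_le_tv_dist:
  assumes "prob_space M" "prob_space N" "A \<in> sets M"
  shows "\<bar>measure M A - measure N A\<bar> \<le> tv_dist M N"
  unfolding tv_dist_def using assms by (intro cSUP_upper bdd_above_tv_dist)

text \<open>The threshold \<open>j\<close> is met exactly for \<open>j\<close> up to the floor of
  \<open>n * x\<close>, and \<open>x \<le> 1\<close> keeps that floor within the index range. For
  positive \<open>n\<close>, dividing by \<open>n\<close> thus approximates \<open>x\<close> to
  within \<open>1 / n\<close>.\<close>

lemma sum_indicator_levels:
  fixes x :: real
  assumes "0 \<le> x" "x \<le> 1"
  shows "(\<Sum>j=1..n. indicator {y. real j \<le> real n * y} x) = real (nat \<lfloor>real n * x\<rfloor>)"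
proof -
  have nx: "real n * x \<le> real n"
    using assms by (simp add: mult_left_le)
  have "{j\<in>{1..n}. real j \<le> real n * x} = {1..nat \<lfloor>real n * x\<rfloor>}"
  proof (intro set_eqI iffI)
    fix j assume "j \<in> {j\<in>{1..n}. real j \<le> real n * x}"
    then show "j \<in> {1..nat \<lfloor>real n * x\<rfloor>}" by (auto simp: le_nat_floor)
  next
    fix j assume j: "j \<in> {1..nat \<lfloor>real n * x\<rfloor>}"
    have "real (nat \<lfloor>real n * x\<rfloor>) \<le> real n * x"
      using assms by (intro of_nat_floor) simp
    then have "real j \<le> real n * x" using j by (auto intro: order_trans[rotated])
    then show "j \<in> {j\<in>{1..n}. real j \<le> real n * x}"
      using j nx by auto
  qed
  moreover have "(\<Sum>j=1..n. indicator {y. real j \<le> real n * y} x)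
      = real (card {j\<in>{1..n}. real j \<le> real n * x})"
    by (simp add: indicator_def sum.If_cases Int_def conj_commute)
  ultimately show ?thesis by simp
qed

text \<open>An average of differences of event probabilities is at most the largest of them, so no
  factor is lost in passing from events to functions with values in the unit interval. For values in
  [-1,1] a factor 2 would appear.\<close>

lemma abs_integral_diff_le_tv_dist:
  fixes f :: "'a \<Rightarrow> real"
  assumes M: "prob_space M" and N: "prob_space N" and sets: "sets M = sets N"
    and f: "f \<in> borel_measurable M" "f \<in> space M \<rightarrow> {0..1}"
  shows "\<bar>(\<integral>x. f x \<partial>M) - (\<integral>x. f x \<partial>N)\<bar> \<le> tv_dist M N"
proof -
  \<comment> \<open>Up to \<open>1 / n\<close>, \<open>f\<close> is the average of the indicators of its superlevel sets \<open>L n j\<close>,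
    \<open>1 \<le> j \<le> n\<close>.\<close>
  define L where "L n j = {x\<in>space M. real j \<le> real n * f x}" for n j :: nat
  have L: "L n j \<in> sets M" for n j
    unfolding L_def using f(1) by measurable
  have levels: "\<bar>(\<integral>x. f x \<partial>K) - (\<Sum>j=1..n. measure K (L n j)) / n\<bar> \<le> 1 / n"
    if K: "prob_space K" "sets K = sets M" and n: "n > 0" for K n
  proof -
    interpret prob_space K by fact
    have spK: "space K = space M" using K(2) by (rule sets_eq_imp_space_eq)
    have fK: "f \<in> borel_measurable K" using f(1) K(2) by (simp cong: measurable_cong_sets)
    have int_f: "integrable K f"
      using fK f(2) spK by (intro integrable_unit_interval finite_measure_axioms) auto
    define g where "g x = (\<Sum>j=1..n. indicator (L n j) x) / real n" for x
    have int_L: "integrable K (indicator (L n j) :: _ \<Rightarrow> real)" for j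
      using L K(2) by (intro integrable_real_indicator) (auto simp: emeasure_eq_measure)
    have int_g: "integrable K g"
      unfolding g_def using int_L by (intro integrable_divide integrable_sum) auto
    have "(\<integral>x. g x \<partial>K) = (\<Sum>j=1..n. measure K (L n j)) / n"
      unfolding g_def using int_L L K(2) sets.sets_into_space[OF L]
      by (simp add: Bochner_Integration.integral_sum spK Int_absorb2)
    moreover have "\<bar>f x - g x\<bar> \<le> 1 / n" if x: "x \<in> space K" for x
    proof -
      have fx: "0 \<le> f x" "f x \<le> 1" using f(2) x spK by auto
      have "g x = (\<Sum>j=1..n. indicator {y. real j \<le> real n * y} (f x)) / real n"
        unfolding g_def L_def using x spK
        by (intro arg_cong2[where f="(/)"] sum.cong) (auto simp: indicator_def)
      then have "n * g x = real (nat \<lfloor>real n * f x\<rfloor>)"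
        using n sum_indicator_levels[OF fx, of n] by simp
      also have "\<dots> = real_of_int \<lfloor>real n * f x\<rfloor>" using fx by simp
      finally have "\<bar>n * f x - n * g x\<bar> \<le> 1" by linarith
      moreover have "n * \<bar>f x - g x\<bar> = \<bar>n * f x - n * g x\<bar>"
        by (simp add: abs_mult flip: right_diff_distrib)
      ultimately show ?thesis using n by (simp add: field_simps)
    qed
    then have "\<bar>\<integral>x. f x - g x \<partial>K\<bar> \<le> 1 / n"
      using int_f int_g
      by (intro order_trans[OF integral_abs_bound] integral_le_const) auto
    ultimately show ?thesis using int_f int_g by simp
  qed
  \<comment> \<open>Each of the two means is within \<open>1 / Suc n\<close> of its average of
    level-set probabilities, hence the 2. Taking \<open>Suc n\<close> avoids division by
    zero.\<close>
  have "\<bar>(\<integral>x. f x \<partial>M) - (\<integral>x. f x \<partial>N)\<bar> \<le> tv_dist M N + 2 / Suc n" for n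
  proof -
    let ?n = "Suc n"
    let ?s = "\<lambda>K. (\<Sum>j=1..?n. measure K (L ?n j)) / ?n"
    have "\<bar>\<Sum>j=1..?n. measure M (L ?n j) - measure N (L ?n j)\<bar> \<le> (\<Sum>j=1..?n. tv_dist M N)"
      by (intro order_trans[OF sum_abs] sum_mono abs_measure_diff_le_tv_dist M N L)
    then have "\<bar>?s M - ?s N\<bar> \<le> tv_dist M N"
      by (simp add: sum_subtractf pos_divide_le_eq mult.commute del: sum.cl_ivl_Suc
          flip: diff_divide_distrib)
    then show ?thesis
      using levels[OF M refl, of ?n] levels[OF N sets[symmetric], of ?n] by simp
  qed
  moreover have "(\<lambda>n. tv_dist M N + 2 / Suc n) \<longlonglongrightarrow> tv_dist M N"
    using tendsto_add[OF tendsto_const LIMSEQ_Suc[OF lim_const_over_n[of "2::real"]]] by simp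
  ultimately show ?thesis by (intro LIMSEQ_le_const) auto
qed

lemma tv_dist_self [simp]: "tv_dist M M = 0"
  unfolding tv_dist_def using sets.empty_sets[of M] by (auto intro!: cSUP_const)

section \<open>Edge sets and average sensitivity\<close>

lemma finite_edges: "G \<in> finite_graphs \<Longrightarrow> finite (edges G)"
  unfolding finite_graphs_def by (auto intro: finite_subset[of _ "Pow (verts G)"])

lemma delete_edge_finite_graphs: "G \<in> finite_graphs \<Longrightarrow> delete_edge G e \<in> finite_graphs"
  by (auto simp: finite_graphs_def delete_edge_def)

lemma avg_sensitivity_edgeless:
  assumes "edges G = {}"
  shows "avg_sensitivity B G = 0"
proof -
  have "delete_edge G e = G" for e
    using assms by (cases G) (simp add: delete_edge_def)
  then show ?thesis by (simp add: avg_sensitivity_def)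
qed

text \<open>Trades the expectation for an unnormalised sum over the edges, the form in which the
  bounds are added up along the induction.\<close>

lemma avg_sensitivity_le_iff:
  fixes c :: real
  assumes "G \<in> finite_graphs" "edges G \<noteq> {}"
  shows "avg_sensitivity B G \<le> c \<longleftrightarrow>
    (\<Sum>e\<in>edges G. tv_dist (B G) (B (delete_edge G e))) \<le> card (edges G) * c"
proof -
  have "card (edges G) > 0" using assms finite_edges by (simp add: card_gt_0_iff)
  then show ?thesis
    unfolding avg_sensitivity_def integral_pmf_of_set[OF assms(2) finite_edges[OF assms(1)]]
    by (simp add: pos_divide_le_eq mult.commute)
qed

text \<open>The supremum in \<open>tv_dist\<close> need not be attained, so for every
  \<open>e\<close> an event is chosen that attains it up to a small error. This choice fixes one
  event per edge.\<close>

lemma sum_tv_dist_leI: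
  fixes M :: "'a measure"
  assumes *: "\<And>B. (\<And>e. B e \<in> sets M) \<Longrightarrow> (\<Sum>e\<in>E. \<bar>measure M (B e) - measure (N e) (B e)\<bar>) \<le> c"
  shows "(\<Sum>e\<in>E. tv_dist M (N e)) \<le> c"
proof (rule field_le_epsilon)
  fix \<epsilon> :: real assume "0 < \<epsilon>"
  \<comment> \<open>The \<open>card E\<close> errors of size \<open>\<delta>\<close> add up to at
    most \<open>\<epsilon>\<close>; the \<open>+ 1\<close> keeps the denominator positive when
    \<open>card E\<close> is 0.\<close>
  define \<delta> where "\<delta> = \<epsilon> / (card E + 1)"
  have \<delta>: "\<delta> > 0" "card E * \<delta> \<le> \<epsilon>"
    using \<open>0 < \<epsilon>\<close> by (auto simp: \<delta>_def field_simps)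
  have "\<exists>A\<in>sets M. tv_dist M (N e) - \<delta> < \<bar>measure M A - measure (N e) A\<bar>" for e
  proof -
    have "tv_dist M (N e) - \<delta> < (SUP A\<in>sets M. \<bar>measure M A - measure (N e) A\<bar>)"
      using \<delta>(1) by (simp add: tv_dist_def)
    from less_cSupD[OF _ this] show ?thesis
      using sets.empty_sets[of M] by blast
  qed
  then obtain B where B: "B e \<in> sets M"
      "tv_dist M (N e) - \<delta> < \<bar>measure M (B e) - measure (N e) (B e)\<bar>" for e
    by metis
  have "(\<Sum>e\<in>E. tv_dist M (N e)) \<le> (\<Sum>e\<in>E. \<bar>measure M (B e) - measure (N e) (B e)\<bar> + \<delta>)"
    using B(2) by (intro sum_mono) (smt (verit))
  also have "\<dots> \<le> c + \<epsilon>"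
    using *[of B] B(1) \<delta>(2) by (simp add: sum.distrib)
  finally show "(\<Sum>e\<in>E. tv_dist M (N e)) \<le> c + \<epsilon>" .
qed

section \<open>Means under probability kernels and their composition\<close>

lemma integral_unit_interval:
  fixes f :: "'a \<Rightarrow> real"
  assumes "prob_space M" "f \<in> borel_measurable M" "f \<in> space M \<rightarrow> {0..1}"
  shows "(\<integral>x. f x \<partial>M) \<in> {0..1}"
proof -
  interpret prob_space M by fact
  have "integrable M f" by (intro integrable_unit_interval finite_measure_axioms assms)
  then show ?thesis
    using assms(3) by (auto intro!: integral_ge_const integral_le_const AE_I2)
qed

lemma kernel_integral_unit_interval:
  fixes f :: "'b \<Rightarrow> real"
  assumes J: "J \<in> N \<rightarrow>\<^sub>M prob_algebra R"
    and f: "f \<in> borel_measurable R" "f \<in> space R \<rightarrow> {0..1}"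
  shows "(\<lambda>x. \<integral>y. f y \<partial>J x) \<in> borel_measurable N"
    and "(\<lambda>x. \<integral>y. f y \<partial>J x) \<in> space N \<rightarrow> {0..1}"
proof -
  show "(\<lambda>x. \<integral>y. f y \<partial>J x) \<in> borel_measurable N"
    using measurable_compose[OF measurable_prob_algebraD[OF J]
        integral_measurable_subprob_algebra[OF f(1)]] .
  show "(\<lambda>x. \<integral>y. f y \<partial>J x) \<in> space N \<rightarrow> {0..1}"
  proof
    fix x assume "x \<in> space N"
    then have J: "prob_space (J x)" "sets (J x) = sets R"
      using measurable_space[OF J] by (auto simp: space_prob_algebra)
    then show "(\<integral>y. f y \<partial>J x) \<in> {0..1}"
      using f sets_eq_imp_space_eq[OF J(2)]
      by (intro integral_unit_interval) (auto cong: measurable_cong_sets)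
  qed
qed

lemma integral_bind_unit_interval:
  fixes f :: "'b \<Rightarrow> real"
  assumes M: "M \<in> space (prob_algebra N)"
    and J: "J \<in> N \<rightarrow>\<^sub>M prob_algebra R"
    and f: "f \<in> borel_measurable R" "f \<in> space R \<rightarrow> {0..1}"
  shows "(\<integral>y. f y \<partial>(M \<bind> J)) = (\<integral>x. \<integral>y. f y \<partial>J x \<partial>M)"
proof -
  have M': "prob_space M" "sets M = sets N" using M by (auto simp: space_prob_algebra)
  interpret prob_space M by fact
  have J': "J \<in> M \<rightarrow>\<^sub>M subprob_algebra R"
    using measurable_prob_algebraD[OF J] M'(2) by (simp cong: measurable_cong_sets)
  have "space M = space N" using M'(2) by (rule sets_eq_imp_space_eq)
  then have "emeasure (J x) (space (J x)) \<le> ennreal 1" if "x \<in> space M" for x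
    using measurable_space[OF J, of x] that
    by (auto simp: space_prob_algebra prob_space.emeasure_space_1)
  \<comment> \<open>\<open>B\<close> bounds the absolute value of \<open>f\<close>, and
    \<open>B'\<close> the total mass of the kernel.\<close>
  then show ?thesis
    using f(2) by (intro integral_bind[where K=R and B=1 and B'=1] f(1) J' AE_I2
        finite_measure_axioms) (auto simp: Pi_iff abs_le_iff)
qed

section \<open>One step of a run, and the joint law of the outputs\<close>

text \<open>Appending coordinate \<open>Suc n\<close> is measurable jointly in the past and the new
  output, so drawing an output and then appending it is again a probability kernel.\<close>

lemma measurable_run_step:
  assumes [measurable]: "K \<in> PiM {1..n} S \<rightarrow>\<^sub>M prob_algebra (S (Suc n))"
  shows "(\<lambda>\<omega>. K \<omega> \<bind> (\<lambda>s. return (PiM {1..Suc n} S) (fun_upd \<omega> (Suc n) s)))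
    \<in> PiM {1..n} S \<rightarrow>\<^sub>M prob_algebra (PiM {1..Suc n} S)"
proof -
  have [measurable]: "(\<lambda>(\<omega>, s). fun_upd \<omega> (Suc n) s)
      \<in> PiM {1..n} S \<Otimes>\<^sub>M S (Suc n) \<rightarrow>\<^sub>M PiM {1..Suc n} S"
    using measurable_add_dim[of "Suc n" "{1..n}" S] by (simp add: atLeastAtMostSuc_conv)
  show ?thesis by measurable
qed

lemma run_in_prob_algebra:
  assumes "\<And>i. i \<in> {1..n} \<Longrightarrow> A i G \<in> PiM {1..<i} S \<rightarrow>\<^sub>M prob_algebra (S i)"
  shows "run S A G n \<in> space (prob_algebra (PiM {1..n} S))"
  using assms
proof (induction n)
  case 0
  \<comment> \<open>The empty product has the single point \<open>\<lambda>_. undefined\<close>, at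
    which the Dirac measure sits.\<close>
  then show ?case
    by (auto simp: space_prob_algebra space_PiM intro!: prob_space_return)
next
  case (Suc n)
  have run: "run S A G n \<in> space (prob_algebra (PiM {1..n} S))"
    using Suc by simp
  have "A (Suc n) G \<in> PiM {1..n} S \<rightarrow>\<^sub>M prob_algebra (S (Suc n))"
    using Suc.prems[of "Suc n"] by (simp add: atLeastLessThanSuc_atLeastAtMost)
  \<comment> \<open>Binding with the step kernel is a measurable map from one space of probability
    measures to the next; it is evaluated at \<open>run S A G n\<close>.\<close>
  from measurable_bind_prob_space[OF measurable_ident measurable_run_step[OF this]]
  show ?case
    using measurable_space[OF _ run] by auto
qed

text \<open>With the past \<open>\<omega>\<close> fixed, appending is deterministic, so both
  integrals are means of the same function of the new output \<open>s\<close> alone, under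
  \<open>K \<omega>\<close> and \<open>K' \<omega>\<close>. That function again takes values in the
  unit interval.\<close>

lemma abs_integral_run_step_diff_le_tv_dist:
  fixes f :: "(nat \<Rightarrow> 'a) \<Rightarrow> real"
  assumes K: "K \<in> PiM {1..n} S \<rightarrow>\<^sub>M prob_algebra (S (Suc n))"
    and K': "K' \<in> PiM {1..n} S \<rightarrow>\<^sub>M prob_algebra (S (Suc n))"
    and f: "f \<in> borel_measurable (PiM {1..Suc n} S)" "f \<in> space (PiM {1..Suc n} S) \<rightarrow> {0..1}"
    and \<omega>: "\<omega> \<in> space (PiM {1..n} S)"
  shows "\<bar>(\<integral>y. f y \<partial>(K \<omega> \<bind> (\<lambda>s. return (PiM {1..Suc n} S) (fun_upd \<omega> (Suc n) s))))
      - (\<integral>y. f y \<partial>(K' \<omega> \<bind> (\<lambda>s. return (PiM {1..Suc n} S) (fun_upd \<omega> (Suc n) s))))\<bar>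
    \<le> tv_dist (K \<omega>) (K' \<omega>)"
proof -
  define R where "R = PiM {1..Suc n} S"
  have "(\<lambda>(\<omega>, s). fun_upd \<omega> (Suc n) s) \<in> PiM {1..n} S \<Otimes>\<^sub>M S (Suc n) \<rightarrow>\<^sub>M R"
    unfolding R_def
    using measurable_add_dim[of "Suc n" "{1..n}" S] by (simp add: atLeastAtMostSuc_conv)
  from measurable_Pair2[OF this \<omega>]
  have upd: "(\<lambda>s. fun_upd \<omega> (Suc n) s) \<in> S (Suc n) \<rightarrow>\<^sub>M R" by simp
  note fR = f[folded R_def]
  have kernel: "prob_space (L \<omega>)" "sets (L \<omega>) = sets (S (Suc n))"
    if "L \<in> PiM {1..n} S \<rightarrow>\<^sub>M prob_algebra (S (Suc n))" for L
    using measurable_space[OF that \<omega>] by (auto simp: space_prob_algebra)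
  \<comment> \<open>Binding with \<open>return\<close> of a measurable map is a pushforward, so this
    is a change of variables.\<close>
  have *: "(\<integral>y. f y \<partial>(L \<omega> \<bind> (\<lambda>s. return R (fun_upd \<omega> (Suc n) s))))
      = (\<integral>s. f (fun_upd \<omega> (Suc n) s) \<partial>L \<omega>)"
    if L: "L \<in> PiM {1..n} S \<rightarrow>\<^sub>M prob_algebra (S (Suc n))" for L
  proof -
    have ne: "space (L \<omega>) \<noteq> {}" using kernel(1)[OF L] by (rule prob_space.not_empty)
    have upd': "(\<lambda>s. fun_upd \<omega> (Suc n) s) \<in> L \<omega> \<rightarrow>\<^sub>M R"
      using upd kernel(2)[OF L] by (simp cong: measurable_cong_sets)
    show ?thesis
      using bind_return_distr'[OF ne upd'] integral_distr[OF upd' fR(1)] by simp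
  qed
  have "(\<lambda>s. f (fun_upd \<omega> (Suc n) s)) \<in> borel_measurable (K \<omega>)"
    using measurable_compose[OF upd fR(1)] kernel(2)[OF K] by (simp cong: measurable_cong_sets)
  moreover have "(\<lambda>s. f (fun_upd \<omega> (Suc n) s)) \<in> space (K \<omega>) \<rightarrow> {0..1}"
    using measurable_space[OF upd] fR(2) sets_eq_imp_space_eq[OF kernel(2)[OF K]] by auto
  ultimately show ?thesis
    unfolding R_def[symmetric] *[OF K] *[OF K'] using kernel[OF K] kernel[OF K']
    by (intro abs_integral_diff_le_tv_dist) auto
qed

section \<open>Induction on the number of algorithms\<close>

text \<open>A hybrid argument: between the runs on \<open>G\<close> and on \<open>H e\<close> stands
  the process whose first \<open>n\<close> outputs come from \<open>G\<close> and whose last comes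
  from \<open>H e\<close>. Replacing the last algorithm costs \<open>c (Suc n)\<close> in total, and
  the rest is the induction hypothesis. The test function depends on \<open>e\<close> and is
  generalised because averaging out the last output under \<open>H e\<close> gives a new one for
  each edge.\<close>

lemma sum_abs_integral_run_diff_le:
  fixes f :: "'e \<Rightarrow> (nat \<Rightarrow> 'a) \<Rightarrow> real"
  assumes A: "\<And>i. i \<in> {1..n} \<Longrightarrow> A i G \<in> PiM {1..<i} S \<rightarrow>\<^sub>M prob_algebra (S i)"
    and A': "\<And>i e. i \<in> {1..n} \<Longrightarrow> e \<in> E \<Longrightarrow> A i (H e) \<in> PiM {1..<i} S \<rightarrow>\<^sub>M prob_algebra (S i)"
    and sens: "\<And>i \<omega>. i \<in> {1..n} \<Longrightarrow> \<omega> \<in> space (PiM {1..<i} S) \<Longrightarrow>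
      (\<Sum>e\<in>E. tv_dist (A i G \<omega>) (A i (H e) \<omega>)) \<le> c i"
    and f: "\<And>e. e \<in> E \<Longrightarrow> f e \<in> borel_measurable (PiM {1..n} S)"
      "\<And>e. e \<in> E \<Longrightarrow> f e \<in> space (PiM {1..n} S) \<rightarrow> {0..1}"
  shows "(\<Sum>e\<in>E. \<bar>(\<integral>x. f e x \<partial>run S A G n) - (\<integral>x. f e x \<partial>run S A (H e) n)\<bar>) \<le> (\<Sum>i=1..n. c i)"
  using assms
proof (induction n arbitrary: f)
  case 0
  then show ?case by simp
next
  case (Suc n)
  let ?P = "PiM {1..n} S" and ?R = "PiM {1..Suc n} S"
  define J where "J g \<omega> = A (Suc n) g \<omega> \<bind> (\<lambda>s. return ?R (fun_upd \<omega> (Suc n) s))" for g \<omega>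
  have K: "A (Suc n) G \<in> ?P \<rightarrow>\<^sub>M prob_algebra (S (Suc n))"
    using Suc.prems(1)[of "Suc n"] by (simp add: atLeastLessThanSuc_atLeastAtMost)
  have K': "A (Suc n) (H e) \<in> ?P \<rightarrow>\<^sub>M prob_algebra (S (Suc n))" if "e \<in> E" for e
    using Suc.prems(2)[of "Suc n" e] that by (simp add: atLeastLessThanSuc_atLeastAtMost)
  have J: "J G \<in> ?P \<rightarrow>\<^sub>M prob_algebra ?R"
    unfolding J_def by (rule measurable_run_step[OF K])
  have J': "J (H e) \<in> ?P \<rightarrow>\<^sub>M prob_algebra ?R" if "e \<in> E" for e
    unfolding J_def by (rule measurable_run_step[OF K'[OF that]])
  have run: "run S A G n \<in> space (prob_algebra ?P)"
    using Suc.prems(1) by (intro run_in_prob_algebra) auto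
  have run': "run S A (H e) n \<in> space (prob_algebra ?P)" if "e \<in> E" for e
    using Suc.prems(2) that by (intro run_in_prob_algebra) auto
  have \<mu>: "prob_space (run S A G n)" "sets (run S A G n) = sets ?P"
    using run by (auto simp: space_prob_algebra)
  interpret \<mu>: prob_space "run S A G n" by fact
  have sp\<mu>: "space (run S A G n) = space ?P" using \<mu>(2) by (rule sets_eq_imp_space_eq)
  \<comment> \<open>The last output is averaged out under \<open>G\<close> in \<open>h\<close> and
    under \<open>H e\<close> in \<open>h'\<close>, leaving test functions of the first
    \<open>n\<close> outputs.\<close>
  define h where "h e \<omega> = (\<integral>y. f e y \<partial>J G \<omega>)" for e \<omega>
  define h' where "h' e \<omega> = (\<integral>y. f e y \<partial>J (H e) \<omega>)" for e \<omega>
  have h: "h e \<in> borel_measurable ?P" "h e \<in> space ?P \<rightarrow> {0..1}"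
    and h': "h' e \<in> borel_measurable ?P" "h' e \<in> space ?P \<rightarrow> {0..1}" if "e \<in> E" for e
    unfolding h_def h'_def
    using kernel_integral_unit_interval[OF J Suc.prems(4,5)[OF that]]
      kernel_integral_unit_interval[OF J'[OF that] Suc.prems(4,5)[OF that]] by auto
  have int_h: "integrable (run S A G n) (h e)" and int_h': "integrable (run S A G n) (h' e)"
    if "e \<in> E" for e
    using h[OF that] h'[OF that] \<mu>(2) sp\<mu>
    by (auto intro!: integrable_unit_interval \<mu>.finite_measure_axioms cong: measurable_cong_sets)
  have run_f: "(\<integral>x. f e x \<partial>run S A G (Suc n)) = (\<integral>\<omega>. h e \<omega> \<partial>run S A G n)"
    "(\<integral>x. f e x \<partial>run S A (H e) (Suc n)) = (\<integral>\<omega>. h' e \<omega> \<partial>run S A (H e) n)" if "e \<in> E" for e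
    using integral_bind_unit_interval[OF run J Suc.prems(4,5)[OF that]]
      integral_bind_unit_interval[OF run'[OF that] J'[OF that] Suc.prems(4,5)[OF that]]
    by (simp_all add: h_def h'_def J_def[abs_def])
  have "(\<Sum>e\<in>E. \<bar>h e \<omega> - h' e \<omega>\<bar>) \<le> c (Suc n)" if \<omega>: "\<omega> \<in> space ?P" for \<omega>
  proof -
    have "(\<Sum>e\<in>E. \<bar>h e \<omega> - h' e \<omega>\<bar>) \<le> (\<Sum>e\<in>E. tv_dist (A (Suc n) G \<omega>) (A (Suc n) (H e) \<omega>))"
      unfolding h_def h'_def J_def
      by (intro sum_mono abs_integral_run_step_diff_le_tv_dist K K' \<omega> Suc.prems(4,5))
    also have "\<dots> \<le> c (Suc n)"
      using Suc.prems(3)[of "Suc n" \<omega>] \<omega> by (simp add: atLeastLessThanSuc_atLeastAtMost)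
    finally show ?thesis .
  qed
  \<comment> \<open>The past is distributed as in the run on \<open>G\<close>, the same law for
    every \<open>e\<close>. Hence the sum over edges stays inside one integral and the pointwise
    bound applies.\<close>
  then have "(\<integral>\<omega>. (\<Sum>e\<in>E. \<bar>h e \<omega> - h' e \<omega>\<bar>) \<partial>run S A G n) \<le> c (Suc n)"
    using int_h int_h' sp\<mu> by (intro \<mu>.integral_le_const AE_I2) auto
  then have last: "(\<Sum>e\<in>E. \<integral>\<omega>. \<bar>h e \<omega> - h' e \<omega>\<bar> \<partial>run S A G n) \<le> c (Suc n)"
    using int_h int_h' by (subst (asm) Bochner_Integration.integral_sum) auto
  \<comment> \<open>The induction hypothesis with \<open>h'\<close> as test functions: the last
    algorithm now uses \<open>H e\<close> on both sides, and only the earlier outputs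
    differ.\<close>
  have earlier: "(\<Sum>e\<in>E. \<bar>(\<integral>\<omega>. h' e \<omega> \<partial>run S A G n) - (\<integral>\<omega>. h' e \<omega> \<partial>run S A (H e) n)\<bar>)
      \<le> (\<Sum>i=1..n. c i)"
    using Suc.prems(1,2,3) h' by (intro Suc.IH) auto
  \<comment> \<open>Triangle inequality through the hybrid mean, that of \<open>h' e\<close> under
    \<open>run S A G n\<close>.\<close>
  have "(\<Sum>e\<in>E. \<bar>(\<integral>x. f e x \<partial>run S A G (Suc n)) - (\<integral>x. f e x \<partial>run S A (H e) (Suc n))\<bar>)
      \<le> (\<Sum>e\<in>E. (\<integral>\<omega>. \<bar>h e \<omega> - h' e \<omega>\<bar> \<partial>run S A G n)
        + \<bar>(\<integral>\<omega>. h' e \<omega> \<partial>run S A G n) - (\<integral>\<omega>. h' e \<omega> \<partial>run S A (H e) n)\<bar>)"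
  proof (rule sum_mono)
    fix e assume e: "e \<in> E"
    have "\<bar>(\<integral>\<omega>. h e \<omega> \<partial>run S A G n) - (\<integral>\<omega>. h' e \<omega> \<partial>run S A G n)\<bar>
        \<le> (\<integral>\<omega>. \<bar>h e \<omega> - h' e \<omega>\<bar> \<partial>run S A G n)"
      using integral_abs_bound[of "run S A G n" "\<lambda>\<omega>. h e \<omega> - h' e \<omega>"] int_h[OF e] int_h'[OF e]
      by simp
    then show "\<bar>(\<integral>x. f e x \<partial>run S A G (Suc n)) - (\<integral>x. f e x \<partial>run S A (H e) (Suc n))\<bar>
        \<le> (\<integral>\<omega>. \<bar>h e \<omega> - h' e \<omega>\<bar> \<partial>run S A G n)
        + \<bar>(\<integral>\<omega>. h' e \<omega> \<partial>run S A G n) - (\<integral>\<omega>. h' e \<omega> \<partial>run S A (H e) n)\<bar>"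
      unfolding run_f[OF e] by linarith
  qed
  also have "\<dots> \<le> (\<Sum>i=1..Suc n. c i)"
    using last earlier by (simp add: sum.distrib)
  finally show ?case .
qed

section \<open>Average sensitivity of the sequential composition\<close>

theorem mainTheorem3:
  fixes k :: nat
    and S :: "nat \<Rightarrow> 'a measure"
    and A :: "nat \<Rightarrow> 'v graph \<Rightarrow> (nat \<Rightarrow> 'a) \<Rightarrow> 'a measure"
    and \<gamma> :: "nat \<Rightarrow> 'v graph \<Rightarrow> real"
  assumes "1 \<le> k"
    and "\<And>i G. i \<in> {1..k} \<Longrightarrow> G \<in> finite_graphs \<Longrightarrow>
           A i G \<in> PiM {1..<i} S \<rightarrow>\<^sub>M prob_algebra (S i)"
    and "\<And>i G \<omega>. i \<in> {1..k} \<Longrightarrow> G \<in> finite_graphs \<Longrightarrow> \<omega> \<in> space (PiM {1..<i} S) \<Longrightarrow>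
           avg_sensitivity (\<lambda>H. A i H \<omega>) G \<le> \<gamma> i G"
  shows "\<forall>G\<in>finite_graphs. avg_sensitivity (seq_composition S A k) G \<le> (\<Sum>i=1..k. \<gamma> i G)"
proof
  fix G :: "'v graph" assume G: "G \<in> finite_graphs"
  note measurable_A = assms(2)
  show "avg_sensitivity (seq_composition S A k) G \<le> (\<Sum>i=1..k. \<gamma> i G)"
  proof (cases "edges G = {}")
    case True
    \<comment> \<open>Without edges every sensitivity is 0, so the hypothesis at any single
      \<open>\<omega>\<close> gives the sign of \<open>\<gamma> i G\<close>. Such an
      \<open>\<omega>\<close> exists because the run of the first \<open>i - 1\<close> algorithms is
      a probability measure on that space.\<close>
    have "0 \<le> \<gamma> i G" if i: "i \<in> {1..k}" for i
    proof -
      have "{1..i - 1} = {1..<i}" using i by auto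
      then have "run S A G (i - 1) \<in> space (prob_algebra (PiM {1..<i} S))"
        using run_in_prob_algebra[of "i - 1" A G S] measurable_A G i by fastforce
      then have "space (PiM {1..<i} S) \<noteq> {}"
        by (metis (mono_tags) mem_Collect_eq prob_space.not_empty sets_eq_imp_space_eq
            space_prob_algebra)
      then obtain \<omega> where "\<omega> \<in> space (PiM {1..<i} S)" by blast
      then show ?thesis
        using assms(3)[OF i G] by (simp add: avg_sensitivity_edgeless[OF True])
    qed
    then show ?thesis
      unfolding avg_sensitivity_edgeless[OF True] by (rule sum_nonneg)
  next
    case False
    let ?E = "edges G" and ?H = "delete_edge G" and ?P = "PiM {1..k} S"
    have run: "run S A g k \<in> space (prob_algebra ?P)" if "g \<in> finite_graphs" for g
      using measurable_A that by (intro run_in_prob_algebra) auto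
    have proj: "(\<lambda>\<omega>. \<omega> k) \<in> ?P \<rightarrow>\<^sub>M S k"
      using assms(1) by (intro measurable_component_singleton) auto
    \<comment> \<open>The output law is the last marginal of the joint law, so an event for the
      output becomes the indicator of a cylinder set, a test function for the induction.\<close>
    have measure_seq: "measure (seq_composition S A k g) B
        = (\<integral>\<omega>. indicator ((\<lambda>\<omega>. \<omega> k) -` B \<inter> space ?P) \<omega> \<partial>run S A g k)"
      if "g \<in> finite_graphs" "B \<in> sets (S k)" for g B
    proof -
      have r: "sets (run S A g k) = sets ?P" "space (run S A g k) = space ?P"
        using run[OF that(1)] by (auto simp: space_prob_algebra dest: sets_eq_imp_space_eq)
      then have "(\<lambda>\<omega>. \<omega> k) \<in> run S A g k \<rightarrow>\<^sub>M S k"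
        using proj by (simp cong: measurable_cong_sets)
      then show ?thesis
        using that r by (simp add: seq_composition_def measure_distr)
    qed
    have "(\<Sum>e\<in>?E. tv_dist (seq_composition S A k G) (seq_composition S A k (?H e)))
        \<le> (\<Sum>i=1..k. card ?E * \<gamma> i G)"
    proof (rule sum_tv_dist_leI)
      fix B :: "'v set \<Rightarrow> 'a set"
      assume "\<And>e. B e \<in> sets (seq_composition S A k G)"
      then have B: "B e \<in> sets (S k)" for e by (simp add: seq_composition_def)
      define f :: "'v set \<Rightarrow> (nat \<Rightarrow> 'a) \<Rightarrow> real"
        where "f e = indicator ((\<lambda>\<omega>. \<omega> k) -` B e \<inter> space ?P)" for e
      have f: "f e \<in> borel_measurable ?P" "f e \<in> space ?P \<rightarrow> {0..1}" for e
        unfolding f_def using measurable_sets[OF proj B] by (auto simp: indicator_def)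
      have sens: "(\<Sum>e\<in>?E. tv_dist (A i G \<omega>) (A i (?H e) \<omega>)) \<le> card ?E * \<gamma> i G"
        if "i \<in> {1..k}" "\<omega> \<in> space (PiM {1..<i} S)" for i \<omega>
        using assms(3)[OF that(1) G that(2)] unfolding avg_sensitivity_le_iff[OF G False] .
      have "(\<Sum>e\<in>?E. \<bar>(\<integral>x. f e x \<partial>run S A G k) - (\<integral>x. f e x \<partial>run S A (?H e) k)\<bar>)
          \<le> (\<Sum>i=1..k. card ?E * \<gamma> i G)"
        by (intro sum_abs_integral_run_diff_le measurable_A sens f G delete_edge_finite_graphs)
      then show "(\<Sum>e\<in>?E. \<bar>measure (seq_composition S A k G) (B e)
          - measure (seq_composition S A k (?H e)) (B e)\<bar>) \<le> (\<Sum>i=1..k. card ?E * \<gamma> i G)"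
        using measure_seq[OF G B] measure_seq[OF delete_edge_finite_graphs[OF G] B]
        by (simp add: f_def)
    qed
    \<comment> \<open>The common factor \<open>card ?E\<close> turns the sums over edges back into
      averages.\<close>
    then show ?thesis
      by (simp add: avg_sensitivity_le_iff[OF G False] sum_distrib_left)
  qed
qed

end
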